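(* Consider the $M[pqrs]$ random walk on $\mathbb{Z}$ described in the context, started in $i_0>0$. Then the expected number of arrivals (visits) $x_n=\sum_{k=0}^\infty p_{i_0,n}^{(k)}$ in state $n$ is $$x_n=\begin{cases} \dfrac{q_0\,\eta_1^{\,n}}{q_2\,\tau_{1,i_0}}&(n<0)\\[2ex] \tau_{1,i_0}^{-1}&(n=0)\\[1ex] \lambda_1^{-1}\left[\xi_1^{\,n-i_0}-\dfrac{\tau_{2,n}}{\tau_{1,i_0}}\right]&(0<n\le i_0)\\[2ex] \lambda_1^{-1}\,\xi_2^{\,n-i_0}\left[1-\dfrac{\tau_{2,i_0}}{\tau_{1,i_0}}\right]&(n\ge i_0), \end{cases}$$ where $$\tau_{i,n}=\left(1-r_0-p_2q_0q_2^{-1}\eta_1^{-1}-p_0\xi_i^{-1}\right)\xi_i^{\,n}\qquad(i=1,2).$$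
   Context: The walk: for $i=1,2$ let $p_i,q_i,r_i,s_i$ be probabilities with $p_i+q_i+r_i+s_i=1$ and $p_iq_is_i>0$. In each state $n<0$, at each time step the particle moves to $n+1$ with probability $p_2$, moves to $n-1$ with probability $q_2$, stays with probability $r_2$, or is absorbed in $n$ (removed) with probability $s_2$. In each state $n>0$ the corresponding probabilities are $p_1,q_1,r_1,s_1$, and in state $0$ they are specific probabilities $p_0,q_0,r_0,s_0$ with $p_0+q_0+r_0+s_0=1$. Here $p_{i,j}^{(k)}$ is the probability that the particle, starting in $i$ at time $0$, has not been absorbed and is in state $j$ after $k$ steps (so $p_{i,j}^{(0)}=\delta(i,j)$). Notation: $$\lambda_i=\sqrt{(1-r_i)^2-4p_iq_i}\quad(i=1,2),\qquad \eta_1=\frac{(1-r_2)+\lambda_2}{2q_2},$$ $$\xi_1=\frac{(1-r_1)+\lambda_1}{2q_1},\qquad \xi_2=\frac{(1-r_1)-\lambda_1}{2q_1}.$$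
   Formalization: The case r_0 = 1 (state 0 a trap that is never left, p_0 = q_0 = s_0 = 0) is excluded: there every τ_{i,n} is 0, so the displayed formulas divide by zero, and x_0 diverges. *)

theory Defs
  imports "HOL-Probability.Probability_Mass_Function"
begin

(* The parameters are functions p q r s of an index in {0, 1, 2}: index 1 is used in the
   positive states, index 2 in the negative states, index 0 in the state 0. *)

definition zone :: "int \<Rightarrow> nat" where
  "zone m = (if m < 0 then 2 else if m = 0 then 0 else 1)"

(* Some m: the particle is alive in state m; None: it has been absorbed.  pmf_of_list is
   only meaningful for nonnegative weights with sum 1. *)

definition step ::
  "(nat \<Rightarrow> real) \<Rightarrow> (nat \<Rightarrow> real) \<Rightarrow> (nat \<Rightarrow> real) \<Rightarrow> (nat \<Rightarrow> real) \<Rightarrow> int option \<Rightarrow> int option pmf"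
where
  "step p q r s x = (case x of
      None \<Rightarrow> return_pmf None
    | Some m \<Rightarrow> pmf_of_list
        [(Some (m + 1), p (zone m)), (Some (m - 1), q (zone m)),
         (Some m, r (zone m)), (None, s (zone m))])"

primrec walk ::
  "(nat \<Rightarrow> real) \<Rightarrow> (nat \<Rightarrow> real) \<Rightarrow> (nat \<Rightarrow> real) \<Rightarrow> (nat \<Rightarrow> real) \<Rightarrow> int \<Rightarrow> nat \<Rightarrow> int option pmf"
where
  "walk p q r s i 0 = return_pmf (Some i)"
| "walk p q r s i (Suc k) = bind_pmf (walk p q r s i k) (step p q r s)"

definition trans_prob ::
  "(nat \<Rightarrow> real) \<Rightarrow> (nat \<Rightarrow> real) \<Rightarrow> (nat \<Rightarrow> real) \<Rightarrow> (nat \<Rightarrow> real) \<Rightarrow> nat \<Rightarrow> int \<Rightarrow> int \<Rightarrow> real"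
where
  "trans_prob p q r s k i j = pmf (walk p q r s i k) (Some j)"

definition lam :: "(nat \<Rightarrow> real) \<Rightarrow> (nat \<Rightarrow> real) \<Rightarrow> (nat \<Rightarrow> real) \<Rightarrow> nat \<Rightarrow> real" where
  "lam p q r i = sqrt ((1 - r i)\<^sup>2 - 4 * p i * q i)"

definition eta1 :: "(nat \<Rightarrow> real) \<Rightarrow> (nat \<Rightarrow> real) \<Rightarrow> (nat \<Rightarrow> real) \<Rightarrow> real" where
  "eta1 p q r = ((1 - r 2) + lam p q r 2) / (2 * q 2)"

(* Only the indices 1 and 2 are meaningful here and in tau; they select the sign of the root,
   while the transition parameters are those of the positive states in both cases. *)

definition xi :: "(nat \<Rightarrow> real) \<Rightarrow> (nat \<Rightarrow> real) \<Rightarrow> (nat \<Rightarrow> real) \<Rightarrow> nat \<Rightarrow> real" where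
  "xi p q r i = (if i = 1 then ((1 - r 1) + lam p q r 1) / (2 * q 1)
                 else ((1 - r 1) - lam p q r 1) / (2 * q 1))"

definition tau :: "(nat \<Rightarrow> real) \<Rightarrow> (nat \<Rightarrow> real) \<Rightarrow> (nat \<Rightarrow> real) \<Rightarrow> nat \<Rightarrow> int \<Rightarrow> real" where
  "tau p q r i n =
     (1 - r 0 - p 2 * q 0 * inverse (q 2) * inverse (eta1 p q r) - p 0 * inverse (xi p q r i))
     * xi p q r i powi n"

end

theory Submission
  imports Defs
begin

text \<open>Conditioning on the last step before an arrival shows that the expected numbers of visits
  \<open>x n\<close> satisfy the balance equations \<open>x = \<delta> + x P\<close>, where \<open>\<delta>\<close> is the unit source at the start
  and \<open>P\<close> the matrix of one-step transition probabilities between living states.  These equations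
  have many solutions; the theorem holds because \<open>x\<close> is also bounded, and boundedness leaves only
  one.

  Finiteness and boundedness come from a Lyapunov function of the walk (\<open>drift_decreases\<close>).  Since
  its expected loss at each step dominates the probability of being in any given state, the loss
  telescopes to a bound of \<open>x n\<close> that is uniform in \<open>n\<close>.

  Within each half-line the balance equations form a second-order linear recurrence with constant
  coefficients.  Absorption puts one characteristic root above \<open>1\<close> and the other below
  (\<open>characteristic_roots\<close>), and a bounded solution on a half-line must follow the one that decays
  (\<open>bounded_recurrence_decays\<close>).  This makes \<open>x\<close> geometric on the negative states, with ratio
  \<open>eta1\<close>, and from the start \<open>i\<close> upwards, with ratio \<open>xi 2\<close>.  Between \<open>0\<close> and \<open>i\<close> the jump caused
  by the source at \<open>i\<close> fixes \<open>x n - xi 2 * x (n - 1)\<close> (\<open>half_line_difference\<close>), so that only the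
  constant \<open>x 0\<close> remains.  The balance equation at \<open>0\<close> determines it as the inverse of
  \<open>tau 1 i\<close>, which is positive because \<open>r 0 < 1\<close> (\<open>tau1_pos\<close>).\<close>

section \<open>Second-order linear recurrences\<close>

text \<open>The quadratic \<open>q * x\<^sup>2 - (1 - r) * x + p\<close> takes the value \<open>- s\<close> at \<open>1\<close> and the value \<open>p\<close> at
  \<open>0\<close>, so a positive absorption probability \<open>s\<close> is what separates its roots by \<open>1\<close>.\<close>

lemma characteristic_roots:
  fixes p q r s :: real
  assumes "p > 0" "q > 0" "s > 0" "p + q + r + s = 1"
  defines "D \<equiv> sqrt ((1 - r)\<^sup>2 - 4 * p * q)"
  defines "a \<equiv> ((1 - r) + D) / (2 * q)" and "b \<equiv> ((1 - r) - D) / (2 * q)"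
  shows "D > 0" "a > 1" "b > 0" "b < 1" "q * (a + b) = 1 - r" "q * (a * b) = p" "q * (a - b) = D"
proof -
  have R: "1 - r = p + q + s" using assms by simp
  have d: "(1 - r)\<^sup>2 - 4 * p * q = (p - q)\<^sup>2 + s * (2 * p + 2 * q + s)"
    unfolding R by algebra
  have "s * (2 * p + 2 * q + s) > 0" using assms(1-3) by simp
  hence pos: "(1 - r)\<^sup>2 - 4 * p * q > 0" unfolding d by (smt (verit) zero_le_power2)
  thus D: "D > 0" unfolding D_def by simp
  have sq: "D\<^sup>2 = (1 - r)\<^sup>2 - 4 * p * q" using pos unfolding D_def by simp
  have D1: "D > p - q + s"
  proof (rule ccontr)
    assume "\<not> D > p - q + s"
    hence "D\<^sup>2 \<le> (p - q + s)\<^sup>2" using D by (intro power_mono) auto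
    moreover have "D\<^sup>2 - (p - q + s)\<^sup>2 = 4 * q * s" unfolding sq R by algebra
    ultimately show False using assms(2,3) by (smt (verit) mult_pos_pos)
  qed
  have D2: "D > q - p - s"
  proof (rule ccontr)
    assume "\<not> D > q - p - s"
    hence "D\<^sup>2 \<le> (q - p - s)\<^sup>2" using D by (intro power_mono) auto
    moreover have "D\<^sup>2 - (q - p - s)\<^sup>2 = 4 * q * s" unfolding sq R by algebra
    ultimately show False using assms(2,3) by (smt (verit) mult_pos_pos)
  qed
  have D3: "D < 1 - r"
  proof (rule ccontr)
    assume "\<not> D < 1 - r"
    hence "(1 - r)\<^sup>2 \<le> D\<^sup>2" using R assms(1-3) by (intro power_mono) linarith+
    thus False unfolding sq using assms(1,2) by (smt (verit) mult_pos_pos)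
  qed
  show "a > 1" unfolding a_def using D2 R assms(2) by (simp add: field_simps)
  show "b > 0" unfolding b_def using D3 assms(2) by simp
  show "b < 1" unfolding b_def using D1 R assms(2) by (simp add: field_simps)
  show "q * (a + b) = 1 - r" unfolding a_def b_def using assms(2) by (simp add: field_simps)
  show "q * (a - b) = D" unfolding a_def b_def using assms(2) by (simp add: field_simps)
  have "a * b = ((1 - r)\<^sup>2 - D\<^sup>2) / (4 * q\<^sup>2)"
    unfolding a_def b_def by (simp add: power2_eq_square algebra_simps)
  also have "\<dots> = p / q" unfolding sq using assms(2) by (simp add: power2_eq_square)
  finally show "q * (a * b) = p" using assms(2) by simp
qed

text \<open>The differences \<open>z (k + 1) - b * z k\<close> are multiplied by \<open>a\<close> at each step.  As \<open>a > 1\<close>, they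
  can stay bounded only if they vanish.\<close>

lemma bounded_recurrence_decays:
  fixes z :: "nat \<Rightarrow> real"
  assumes "a > 1" and bound: "\<And>k. \<bar>z k\<bar> \<le> M"
    and rec: "\<And>k. z (Suc (Suc k)) = (a + b) * z (Suc k) - a * b * z k"
  shows "z (Suc k) = b * z k"
proof -
  define e where "e k = z (Suc k) - b * z k" for k
  have e: "e (Suc k) = a * e k" for k unfolding e_def using rec[of k] by (simp add: algebra_simps)
  have e_pow: "e (k + m) = a ^ m * e k" for k m
    by (induction m) (auto simp: e)
  have e_bound: "\<bar>e k\<bar> \<le> M + \<bar>b\<bar> * M" for k
  proof -
    have "\<bar>e k\<bar> \<le> \<bar>z (Suc k)\<bar> + \<bar>b\<bar> * \<bar>z k\<bar>"
      unfolding e_def using abs_triangle_ineq4[of "z (Suc k)" "b * z k"] by (simp add: abs_mult)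
    also have "\<dots> \<le> M + \<bar>b\<bar> * M" by (intro add_mono mult_left_mono bound) auto
    finally show ?thesis .
  qed
  have "e k = 0"
  proof (rule ccontr)
    assume nz: "e k \<noteq> 0"
    obtain m where "(M + \<bar>b\<bar> * M) / \<bar>e k\<bar> < a ^ m" using real_arch_pow assms(1) by blast
    hence "M + \<bar>b\<bar> * M < \<bar>e (k + m)\<bar>"
      using nz assms(1) by (simp add: e_pow abs_mult field_simps)
    thus False using e_bound[of "k + m"] by simp
  qed
  thus ?thesis unfolding e_def by simp
qed

section \<open>Transition probabilities and survival\<close>

locale absorbing_walk =
  fixes p q r s :: "nat \<Rightarrow> real"
  assumes nonneg: "\<And>i. i \<le> 2 \<Longrightarrow> p i \<ge> 0 \<and> q i \<ge> 0 \<and> r i \<ge> 0 \<and> s i \<ge> 0"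
    and sum1: "\<And>i. i \<le> 2 \<Longrightarrow> p i + q i + r i + s i = 1"
    and pos: "\<And>i. i \<in> {1, 2} \<Longrightarrow> p i * q i * s i > 0"
    and r0: "r 0 \<noteq> 1"
begin

lemma positive_off_zero:
  assumes "i \<in> {1, 2}"
  shows "p i > 0" "q i > 0" "s i > 0"
proof -
  have "i \<le> 2" using assms by auto
  with nonneg[of i] pos[OF assms] show "p i > 0" "q i > 0" "s i > 0"
    by (auto simp: less_le)
qed

lemma positive_rates_1: "p 1 > 0" "q 1 > 0" "s 1 > 0"
  and positive_rates_2: "p 2 > 0" "q 2 > 0" "s 2 > 0"
  by (simp_all add: positive_off_zero)

lemma r0_less: "r 0 < 1"
  using nonneg[of 0] sum1[of 0] r0 by simp

lemma zone_le: "zone m \<le> 2"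
  by (simp add: zone_def)

lemma step_list_wf:
  "pmf_of_list_wf [(Some (m + 1), p (zone m)), (Some (m - 1), q (zone m)),
     (Some m, r (zone m)), (None, s (zone m))]"
  using nonneg[OF zone_le[of m]] sum1[OF zone_le[of m]]
  by (auto simp: pmf_of_list_wf_def)

lemma pmf_step_Some:
  "pmf (step p q r s (Some m)) y =
     (if y = Some (m + 1) then p (zone m) else if y = Some (m - 1) then q (zone m)
      else if y = Some m then r (zone m) else if y = None then s (zone m) else 0)"
  unfolding step_def by (auto simp: pmf_pmf_of_list[OF step_list_wf])

lemma expectation_step:
  fixes f :: "int option \<Rightarrow> real"
  shows "measure_pmf.expectation (step p q r s (Some m)) f =
     p (zone m) * f (Some (m + 1)) + q (zone m) * f (Some (m - 1))
     + r (zone m) * f (Some m) + s (zone m) * f None"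
proof -
  have "measure_pmf.expectation (step p q r s (Some m)) f =
    (\<Sum>y\<in>{Some (m + 1), Some (m - 1), Some m, None}. f y * pmf (step p q r s (Some m)) y)"
    by (rule integral_measure_pmf_real)
       (auto simp: set_pmf_iff pmf_step_Some split: if_splits)
  also have "\<dots> = p (zone m) * f (Some (m + 1)) + q (zone m) * f (Some (m - 1))
     + r (zone m) * f (Some m) + s (zone m) * f None"
    by (simp add: pmf_step_Some)
  finally show ?thesis .
qed

lemma trans_prob_0: "trans_prob p q r s 0 i j = (if j = i then 1 else 0)"
  by (simp add: trans_prob_def)

lemma trans_prob_Suc:
  "trans_prob p q r s (Suc k) i j =
     trans_prob p q r s k i (j - 1) * p (zone (j - 1))
     + trans_prob p q r s k i j * r (zone j)
     + trans_prob p q r s k i (j + 1) * q (zone (j + 1))"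
proof -
  have "trans_prob p q r s (Suc k) i j =
      measure_pmf.expectation (walk p q r s i k) (\<lambda>x. pmf (step p q r s x) (Some j))"
    by (simp add: trans_prob_def pmf_bind)
  also have "\<dots> = (\<Sum>x\<in>{Some (j - 1), Some j, Some (j + 1)}.
      pmf (step p q r s x) (Some j) * pmf (walk p q r s i k) x)"
  proof (rule integral_measure_pmf_real)
    fix x assume nz: "pmf (step p q r s x) (Some j) \<noteq> 0"
    show "x \<in> {Some (j - 1), Some j, Some (j + 1)}"
    proof (cases x)
      case None
      then show ?thesis using nz by (simp add: step_def)
    next
      case (Some m)
      then show ?thesis using nz by (auto simp: pmf_step_Some split: if_splits)
    qed
  qed auto
  also have "\<dots> = trans_prob p q r s k i (j - 1) * p (zone (j - 1))
     + trans_prob p q r s k i j * r (zone j)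
     + trans_prob p q r s k i (j + 1) * q (zone (j + 1))"
    by (simp add: pmf_step_Some trans_prob_def)
  finally show ?thesis .
qed

text \<open>At this height, the loss by absorption outside \<open>0\<close> outweighs a possible move to \<open>0\<close>, where
  \<open>drift\<close> has its surplus.\<close>

definition drift_height :: real where
  "drift_height = (1 + 1 / (1 - r 0)) / min (s 1) (s 2)"

text \<open>A Lyapunov function: it loses at least \<open>1\<close> in expectation at every step of a living particle,
  so its initial value bounds the expected lifetime.  The surplus \<open>1 / (1 - r 0)\<close> at \<open>0\<close> covers the
  case \<open>s 0 = 0\<close>, in which only the departure to a neighbour decreases it.\<close>

definition drift :: "int option \<Rightarrow> real" where
  "drift x = (case x of None \<Rightarrow> 0
     | Some m \<Rightarrow> drift_height + (if m = 0 then 1 / (1 - r 0) else 0))"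

lemma drift_height_nonneg: "drift_height \<ge> 0"
  unfolding drift_height_def using r0_less positive_rates_1 positive_rates_2 by simp

lemma drift_nonneg: "drift x \<ge> 0"
  unfolding drift_def using drift_height_nonneg r0_less by (auto split: option.split)

lemma drift_le: "drift x \<le> drift_height + 1 / (1 - r 0)"
  unfolding drift_def using drift_height_nonneg r0_less by (auto split: option.split)

lemma integrable_drift: "integrable (measure_pmf M) drift"
  by (rule measure_pmf.integrable_const_bound[where B = "drift_height + 1 / (1 - r 0)"])
     (use drift_nonneg drift_le in auto)

lemma drift_decreases:
  "measure_pmf.expectation (step p q r s (Some m)) drift \<le> drift (Some m) - 1"
proof -
  define B where "B = 1 / (1 - r 0)"
  define A where "A = drift_height"
  have B: "B > 0" "B * (1 - r 0) = 1" unfolding B_def using r0_less by auto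
  have A: "A \<ge> 0" unfolding A_def by (rule drift_height_nonneg)
  show ?thesis
  proof (cases "m = 0")
    case True
    have "drift (Some 0) - measure_pmf.expectation (step p q r s (Some 0)) drift
        = (A + B) - ((p 0 + q 0) * A + r 0 * (A + B))"
      unfolding expectation_step by (simp add: drift_def A_def B_def zone_def algebra_simps)
    also have "\<dots> = s 0 * A + B * (1 - r 0)"
    proof -
      have "p 0 + q 0 = 1 - r 0 - s 0" using sum1[of 0] by simp
      thus ?thesis by (simp only:) (simp add: algebra_simps)
    qed
    also have "\<dots> \<ge> 1" using B A nonneg[of 0] by simp
    finally show ?thesis using True by simp
  next
    case False
    define i where "i = zone m"
    have i: "i \<in> {1, 2}" using False by (auto simp: i_def zone_def)
    hence i2: "i \<le> 2" by auto
    have "min (s 1) (s 2) > 0" using positive_rates_1 positive_rates_2 by simp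
    hence "min (s 1) (s 2) \<noteq> 0" by linarith
    hence "1 + B = min (s 1) (s 2) * A"
      unfolding A_def B_def drift_height_def by simp
    also have "\<dots> \<le> s i * A" using i A by (intro mult_right_mono) auto
    finally have sA: "1 + B \<le> s i * A" .
    \<comment> \<open>Only one of the two neighbours can be \<open>0\<close>.\<close>
    have "measure_pmf.expectation (step p q r s (Some m)) drift
        = (p i + q i + r i) * A + (if m = -1 then p i * B else if m = 1 then q i * B else 0)"
      unfolding expectation_step
      using False by (auto simp: drift_def A_def B_def i_def[symmetric] algebra_simps)
    also have "\<dots> \<le> (1 - s i) * A + B"
    proof (rule add_mono)
      show "(p i + q i + r i) * A \<le> (1 - s i) * A"
        using sum1[OF i2] A by (intro mult_right_mono) auto
      have "p i \<le> 1" "q i \<le> 1" using nonneg[OF i2] sum1[OF i2] by linarith+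
      thus "(if m = -1 then p i * B else if m = 1 then q i * B else 0) \<le> B" using B(1) by auto
    qed
    also have "\<dots> \<le> A - 1" using sA by (simp add: algebra_simps)
    also have "\<dots> = drift (Some m) - 1" using False by (simp add: drift_def A_def)
    finally show ?thesis .
  qed
qed

text \<open>The loss in step \<open>k\<close> is at least the probability of being alive at time \<open>k\<close>, hence at least
  that of being in the particular state \<open>j\<close>.\<close>

lemma trans_prob_le_drift_loss:
  "trans_prob p q r s k i j \<le>
     measure_pmf.expectation (walk p q r s i k) drift
     - measure_pmf.expectation (walk p q r s i (Suc k)) drift"
proof -
  let ?W = "walk p q r s i k"
  let ?next = "\<lambda>x. measure_pmf.expectation (step p q r s x) drift"
  have "\<bar>?next x\<bar> \<le> drift_height + 1 / (1 - r 0)" for x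
  proof -
    have "?next x \<ge> 0" by (intro integral_nonneg_AE) (simp add: drift_nonneg)
    moreover have "?next x \<le> drift_height + 1 / (1 - r 0)"
      by (rule measure_pmf.integral_le_const[OF integrable_drift]) (simp add: drift_le)
    ultimately show ?thesis by simp
  qed
  hence int_next: "integrable (measure_pmf ?W) ?next"
    by (intro measure_pmf.integrable_const_bound[where B = "drift_height + 1 / (1 - r 0)"]) auto
  have int_ind: "integrable (measure_pmf ?W) (indicator {Some j} :: _ \<Rightarrow> real)"
    by (rule measure_pmf.integrable_const_bound[where B = 1]) (auto simp: indicator_def)
  have "measure_pmf.expectation (walk p q r s i (Suc k)) drift = measure_pmf.expectation ?W ?next"
  proof -
    have "measure_pmf.expectation (bind_pmf ?W (step p q r s)) drift
        = measure_pmf.expectation ?W ?next"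
      unfolding measure_pmf_bind
      by (rule integral_bind[where K = "count_space UNIV" and B = "drift_height + 1 / (1 - r 0)"
            and B' = 1])
         (use drift_nonneg drift_le in
           \<open>auto simp: measure_pmf_in_subprob_algebra measure_pmf.emeasure_space_1\<close>)
    thus ?thesis by simp
  qed
  moreover have "trans_prob p q r s k i j = measure_pmf.expectation ?W (indicator {Some j})"
    by (simp add: trans_prob_def measure_pmf_single)
  moreover have "measure_pmf.expectation ?W (indicator {Some j}) + measure_pmf.expectation ?W ?next
      = measure_pmf.expectation ?W (\<lambda>x. indicator {Some j} x + ?next x)"
    using int_ind int_next by simp
  moreover have "\<dots> \<le> measure_pmf.expectation ?W drift"
  proof (rule integral_mono)
    fix x
    show "indicator {Some j} x + ?next x \<le> drift x"
    proof (cases x)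
      case None
      then show ?thesis by (simp add: step_def drift_def)
    next
      case (Some m)
      then show ?thesis using drift_decreases[of m] by (auto simp: indicator_def)
    qed
  qed (use int_ind int_next integrable_drift in auto)
  ultimately show ?thesis by simp
qed

lemma sum_trans_prob_le:
  "(\<Sum>k<N. trans_prob p q r s k i j) \<le> drift (Some i)"
proof -
  have "(\<Sum>k<N. trans_prob p q r s k i j) \<le>
    (\<Sum>k<N. measure_pmf.expectation (walk p q r s i k) drift
           - measure_pmf.expectation (walk p q r s i (Suc k)) drift)"
    by (intro sum_mono trans_prob_le_drift_loss)
  also have "\<dots> = measure_pmf.expectation (walk p q r s i 0) drift
      - measure_pmf.expectation (walk p q r s i N) drift"
    by (rule sum_lessThan_telescope')
  also have "\<dots> \<le> drift (Some i)"
    using integral_nonneg_AE[of drift "measure_pmf (walk p q r s i N)"] by (simp add: drift_nonneg)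
  finally show ?thesis .
qed

section \<open>Expected numbers of visits\<close>

definition visits :: "int \<Rightarrow> int \<Rightarrow> real" where
  "visits i j = (\<Sum>k. trans_prob p q r s k i j)"

lemma summable_trans_prob: "summable (\<lambda>k. trans_prob p q r s k i j)"
  by (rule summableI_nonneg_bounded[OF _ sum_trans_prob_le]) (simp add: trans_prob_def)

lemma trans_prob_sums_visits: "(\<lambda>k. trans_prob p q r s k i j) sums visits i j"
  unfolding visits_def using summable_trans_prob by (rule summable_sums)

lemma visits_bounded: "\<bar>visits i j\<bar> \<le> drift (Some i)"
proof -
  have "visits i j \<ge> 0"
    unfolding visits_def by (rule suminf_nonneg[OF summable_trans_prob]) (simp add: trans_prob_def)
  moreover have "visits i j \<le> drift (Some i)"
    unfolding visits_def by (rule suminf_le_const[OF summable_trans_prob sum_trans_prob_le])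
  ultimately show ?thesis by simp
qed

lemma visits_balance:
  "visits i j = (if j = i then 1 else 0) + visits i (j - 1) * p (zone (j - 1))
     + visits i j * r (zone j) + visits i (j + 1) * q (zone (j + 1))"
proof -
  have "(\<lambda>k. trans_prob p q r s (Suc k) i j) sums
      (visits i (j - 1) * p (zone (j - 1)) + visits i j * r (zone j)
       + visits i (j + 1) * q (zone (j + 1)))"
    unfolding trans_prob_Suc by (intro sums_add sums_mult2 trans_prob_sums_visits)
  from sums_Suc[OF this] have "visits i j =
      visits i (j - 1) * p (zone (j - 1)) + visits i j * r (zone j)
       + visits i (j + 1) * q (zone (j + 1)) + trans_prob p q r s 0 i j"
    using trans_prob_sums_visits sums_unique2 by blast
  thus ?thesis by (simp add: trans_prob_0)
qed

section \<open>Solving the balance equations\<close>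

lemma xi_props:
  shows "lam p q r 1 > 0" "xi p q r 1 > 1" "xi p q r 2 > 0"
    "q 1 * (xi p q r 1 + xi p q r 2) = 1 - r 1" "q 1 * (xi p q r 1 * xi p q r 2) = p 1"
    "q 1 * (xi p q r 1 - xi p q r 2) = lam p q r 1"
  using characteristic_roots[of "p 1" "q 1" "s 1" "r 1"] positive_rates_1 sum1[of 1]
  by (simp_all add: lam_def xi_def)

text \<open>The second conclusion says that the other root \<open>p 2 / (q 2 * eta1)\<close> lies below \<open>1\<close>.\<close>

lemma eta1_props:
  shows "eta1 p q r > 1" "p 2 < q 2 * eta1 p q r"
    "q 2 * (eta1 p q r)\<^sup>2 + p 2 = (1 - r 2) * eta1 p q r"
proof -
  define e where "e = ((1 - r 2) - lam p q r 2) / (2 * q 2)"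
  have e: "eta1 p q r > 1" "e < 1" "q 2 * (eta1 p q r + e) = 1 - r 2" "q 2 * (eta1 p q r * e) = p 2"
    using characteristic_roots[of "p 2" "q 2" "s 2" "r 2"] positive_rates_2 sum1[of 2]
    by (simp_all add: lam_def eta1_def e_def)
  show "eta1 p q r > 1" by fact
  have "q 2 * (eta1 p q r * e) < q 2 * (eta1 p q r * 1)"
    using e(1,2) positive_rates_2 by simp
  thus "p 2 < q 2 * eta1 p q r" using e(4) by simp
  show "q 2 * (eta1 p q r)\<^sup>2 + p 2 = (1 - r 2) * eta1 p q r"
    unfolding e(3)[symmetric] e(4)[symmetric] by (simp add: power2_eq_square algebra_simps)
qed

text \<open>The coefficient of \<open>visits i 0\<close> in the balance equation at \<open>0\<close> once the negative states are
  eliminated: the probability of leaving \<open>0\<close> upwards, by absorption, or downwards for good.\<close>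

definition escape_weight :: real where
  "escape_weight = 1 - r 0 - p 2 * q 0 * inverse (q 2) * inverse (eta1 p q r)"

lemma tau_escape_weight:
  "tau p q r i n = (escape_weight - p 0 * inverse (xi p q r i)) * xi p q r i powi n"
  by (simp add: tau_def escape_weight_def)

text \<open>As \<open>1 - r 0 = p 0 + q 0 + s 0\<close>, the factor before the power of \<open>xi 1\<close> is the probability of
  leaving \<open>0\<close> minus that of leaving it and returning: \<open>e\<close> and \<open>f\<close> below are the probabilities of
  reaching \<open>0\<close> from \<open>- 1\<close> and from \<open>1\<close>, and absorption makes both less than \<open>1\<close>.\<close>

lemma tau1_pos: "tau p q r 1 n > 0"
proof -
  define e where "e = p 2 * inverse (q 2) * inverse (eta1 p q r)"
  define f where "f = inverse (xi p q r 1)"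
  have e: "e < 1" unfolding e_def
    using eta1_props(1,2) positive_rates_2 by (simp add: field_simps)
  have f: "f < 1" unfolding f_def using xi_props(2) by (simp add: field_simps)
  have "escape_weight - p 0 * f = s 0 + q 0 * (1 - e) + p 0 * (1 - f)"
    unfolding escape_weight_def e_def using sum1[of 0] by (simp add: algebra_simps)
  also have "\<dots> > 0"
  proof -
    have "s 0 > 0 \<or> q 0 > 0 \<or> p 0 > 0" using sum1[of 0] nonneg[of 0] r0_less by linarith
    moreover have "s 0 \<ge> 0" "q 0 * (1 - e) \<ge> 0" "p 0 * (1 - f) \<ge> 0" using nonneg[of 0] e f by auto
    moreover have "q 0 > 0 \<Longrightarrow> q 0 * (1 - e) > 0" "p 0 > 0 \<Longrightarrow> p 0 * (1 - f) > 0"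
      using e f by auto
    ultimately show ?thesis by linarith
  qed
  finally show ?thesis unfolding tau_escape_weight f_def using xi_props(2) by simp
qed

text \<open>Reading outwards from \<open>0\<close> inverts the ratios, so the decaying root is \<open>1 / eta1\<close>.\<close>

lemma visits_negative:
  assumes "i > 0"
  shows "visits i (- 1 - int k) = q 0 * visits i 0 / q 2 * eta1 p q r powi (- 1 - int k)"
proof -
  \<comment> \<open>The virtual value at \<open>0\<close> supplies \<open>- 1\<close> with the true inflow \<open>q 0 * visits i 0\<close> at the rate
    \<open>q 2\<close> of the negative states, which makes the recurrence hold from the first step on.\<close>
  define y where "y k = (if k = 0 then q 0 * visits i 0 / q 2 else visits i (- int k))" for k
  define h where "h = eta1 p q r"
  define g where "g = q 2 * h / p 2"
  have h: "h > 1" "p 2 < q 2 * h" "q 2 * h\<^sup>2 + p 2 = (1 - r 2) * h"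
    using eta1_props by (simp_all add: h_def)
  have y: "y (Suc k) = 1 / h * y k" for k
  proof (rule bounded_recurrence_decays[where a = g
        and M = "\<bar>q 0 * visits i 0 / q 2\<bar> + drift (Some i)"])
    show "g > 1" unfolding g_def using h positive_rates_2 by simp
    show "\<bar>y k\<bar> \<le> \<bar>q 0 * visits i 0 / q 2\<bar> + drift (Some i)" for k
      unfolding y_def using visits_bounded[of i "- int k"] drift_nonneg[of "Some i"]
      by (cases "k = 0") (simp_all add: add_increasing)
    fix k
    have balance: "(1 - r 2) * y (Suc k) = p 2 * y (Suc (Suc k)) + q 2 * y k"
    proof (cases k)
      case 0
      then show ?thesis using visits_balance[of i "-1"] assms positive_rates_2
        by (simp add: y_def zone_def algebra_simps)
    next
      case (Suc l)
      have "- int (Suc k) - 1 = - int (Suc (Suc k))" "- int (Suc k) + 1 = - int k" by simp_all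
      with visits_balance[of i "- int (Suc k)"] show ?thesis
        using assms Suc by (simp add: y_def zone_def algebra_simps)
    qed
    have "p 2 * (g + 1 / h) = (q 2 * h\<^sup>2 + p 2) / h"
      using h(1) positive_rates_2 by (simp add: g_def field_simps power2_eq_square)
    also have "\<dots> = 1 - r 2" unfolding h(3) using h(1) by simp
    finally have sum_roots: "p 2 * (g + 1 / h) = 1 - r 2" .
    have prod_roots: "p 2 * (g * (1 / h)) = q 2"
      using h(1) positive_rates_2 by (simp add: g_def)
    have "p 2 * y (Suc (Suc k)) = p 2 * ((g + 1 / h) * y (Suc k) - g * (1 / h) * y k)"
      using balance unfolding sum_roots[symmetric] prod_roots[symmetric]
      by (simp only: right_diff_distrib mult.assoc)
    thus "y (Suc (Suc k)) = (g + 1 / h) * y (Suc k) - g * (1 / h) * y k"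
      by (rule iffD1[OF mult_left_cancel, rotated]) (use positive_rates_2 in simp)
  qed
  have "y k = y 0 * h powi (- int k)" for k
  proof (induction k)
    case (Suc k)
    have "h powi (- int (Suc k)) = h powi (- int k) / h"
      by (simp only: power_int_minus power_int_of_nat power_Suc) (simp add: field_simps)
    with Suc show ?case by (simp add: y)
  qed simp
  from this[of "Suc k"] show ?thesis by (simp add: y_def h_def)
qed

lemma visits_beyond_start:
  assumes "i > 0" "n \<ge> i"
  shows "visits i n = visits i i * xi p q r 2 powi (n - i)"
proof -
  have z: "visits i (i + int (Suc k)) = xi p q r 2 * visits i (i + int k)" for k
  proof (rule bounded_recurrence_decays[where z = "\<lambda>k. visits i (i + int k)" and a = "xi p q r 1"])
    show "xi p q r 1 > 1" by (rule xi_props)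
    show "\<bar>visits i (i + int k)\<bar> \<le> drift (Some i)" for k by (rule visits_bounded)
    fix k
    have "i + int (Suc k) - 1 = i + int k" "i + int (Suc k) + 1 = i + int (Suc (Suc k))" by simp_all
    with visits_balance[of i "i + int (Suc k)"] assms(1)
    have "q 1 * visits i (i + int (Suc (Suc k)))
        = (1 - r 1) * visits i (i + int (Suc k)) - p 1 * visits i (i + int k)"
      by (simp add: zone_def algebra_simps)
    also have "\<dots> = q 1 * ((xi p q r 1 + xi p q r 2) * visits i (i + int (Suc k))
        - xi p q r 1 * xi p q r 2 * visits i (i + int k))"
      unfolding xi_props(4)[symmetric] xi_props(5)[symmetric] by (simp add: algebra_simps)
    finally show "visits i (i + int (Suc (Suc k))) =
        (xi p q r 1 + xi p q r 2) * visits i (i + int (Suc k))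
        - xi p q r 1 * xi p q r 2 * visits i (i + int k)"
      using positive_rates_1 by simp
  qed
  have "visits i (i + int k) = visits i i * xi p q r 2 powi int k" for k
    by (induction k) (use z in \<open>auto simp: power_int_add\<close>)
  from this[of "nat (n - i)"] assms show ?thesis by simp
qed

text \<open>The value at \<open>0\<close> is chosen so that, with the upward probability \<open>p 1\<close> of the positive states, it
  gives \<open>1\<close> the true inflow \<open>p 0 * visits i 0\<close>.  The balance equation at \<open>1\<close> then becomes an
  instance of the constant-coefficient recurrence.\<close>

definition half_line_visits :: "int \<Rightarrow> int \<Rightarrow> real" where
  "half_line_visits i n = (if n = 0 then p 0 * visits i 0 / p 1 else visits i n)"

lemma half_line_recurrence:
  assumes "i > 0" "n > 0"
  shows "(xi p q r 1 + xi p q r 2) * half_line_visits i n =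
     (if n = i then 1 / q 1 else 0) + xi p q r 1 * xi p q r 2 * half_line_visits i (n - 1)
     + half_line_visits i (n + 1)"
proof -
  have "(1 - r 1) * half_line_visits i n =
     (if n = i then 1 else 0) + p 1 * half_line_visits i (n - 1) + q 1 * half_line_visits i (n + 1)"
    using visits_balance[of i n] assms positive_rates_1
    by (auto simp: half_line_visits_def zone_def algebra_simps)
  hence "q 1 * ((xi p q r 1 + xi p q r 2) * half_line_visits i n) = q 1 *
     ((if n = i then 1 / q 1 else 0) + xi p q r 1 * xi p q r 2 * half_line_visits i (n - 1)
     + half_line_visits i (n + 1))"
    unfolding xi_props(4)[symmetric] xi_props(5)[symmetric]
    using positive_rates_1 by (simp add: algebra_simps)
  thus ?thesis using positive_rates_1 by simp
qed

text \<open>The left-hand side is multiplied by \<open>xi 1\<close> from each \<open>n < i\<close> to the next.  Beyond the start it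
  vanishes, so its value at \<open>i\<close> is fixed by the unit source there, and the values below follow by
  going down.\<close>

lemma half_line_difference:
  assumes "i > 0" "0 < n" "n \<le> i"
  shows "half_line_visits i n - xi p q r 2 * half_line_visits i (n - 1)
    = xi p q r 1 powi (n - i - 1) / q 1"
  using assms(3,2)
proof (induction n rule: int_le_induct)
  case base
  have "half_line_visits i (i + 1) = xi p q r 2 * half_line_visits i i"
    using visits_beyond_start[of i "i + 1"] assms(1) by (simp add: half_line_visits_def)
  with half_line_recurrence[of i i] assms(1)
  have "xi p q r 1 * (half_line_visits i i - xi p q r 2 * half_line_visits i (i - 1)) = 1 / q 1"
    by (simp add: algebra_simps)
  hence "half_line_visits i i - xi p q r 2 * half_line_visits i (i - 1)
      = 1 / q 1 / xi p q r 1"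
    using xi_props(2) by (simp only: nonzero_eq_divide_eq mult.commute)
  then show ?case by (simp add: power_int_minus field_simps)
next
  case (step n)
  have "xi p q r 1 * (half_line_visits i (n - 1) - xi p q r 2 * half_line_visits i (n - 1 - 1))
      = half_line_visits i n - xi p q r 2 * half_line_visits i (n - 1)"
    using half_line_recurrence[of i "n - 1"] step.prems step.hyps assms(1)
    by (simp add: algebra_simps)
  also have "\<dots> = xi p q r 1 powi (n - i - 1) / q 1" using step by simp
  also have "\<dots> = xi p q r 1 * (xi p q r 1 powi (n - 1 - i - 1) / q 1)"
    using xi_props(2) power_int_add[of "xi p q r 1" 1 "n - 1 - i - 1"] by simp
  finally show ?case
    by (rule iffD1[OF mult_left_cancel, rotated]) (use xi_props(2) in simp)
qed

lemma visits_zero: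
  assumes "i > 0"
  shows "visits i 0 = inverse (tau p q r 1 i)"
proof -
  let ?x = "visits i 0"
  have f: "q 1 * xi p q r 2 / p 1 = inverse (xi p q r 1)"
    using xi_props(2,3) positive_rates_1 unfolding xi_props(5)[symmetric] by (simp add: field_simps)
  have "q 1 * visits i 1 = q 1 * (xi p q r 2 * (p 0 * ?x / p 1) + xi p q r 1 powi (- i) / q 1)"
    using half_line_difference[of i 1] assms by (simp add: half_line_visits_def)
  also have "\<dots> = p 0 * ?x * (q 1 * xi p q r 2 / p 1) + xi p q r 1 powi (- i)"
    using positive_rates_1 by (simp add: field_simps)
  finally have right: "q 1 * visits i 1 = p 0 * ?x * inverse (xi p q r 1) + xi p q r 1 powi (- i)"
    unfolding f .
  have left: "visits i (- 1) = q 0 * ?x * inverse (q 2) * inverse (eta1 p q r)"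
    using visits_negative[OF assms, of 0] by (simp add: field_simps)
  have "?x = p 2 * visits i (- 1) + r 0 * ?x + q 1 * visits i 1"
    using visits_balance[of i 0] assms by (simp add: zone_def algebra_simps)
  hence "?x * (escape_weight - p 0 * inverse (xi p q r 1)) = xi p q r 1 powi (- i)"
    unfolding left right by (simp add: escape_weight_def algebra_simps)
  hence "?x * tau p q r 1 i = xi p q r 1 powi (- i) * xi p q r 1 powi i"
    unfolding tau_escape_weight by (simp add: mult.assoc)
  also have "\<dots> = 1" using xi_props(2) by (simp add: power_int_minus)
  finally show ?thesis using tau1_pos[of i] by (simp add: field_simps)
qed

lemma half_line_visits_below_start:
  assumes "i > 0" "0 \<le> n" "n \<le> i"
  shows "half_line_visits i n =
    inverse (lam p q r 1) * (xi p q r 1 powi (n - i) - tau p q r 2 n / tau p q r 1 i)"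
  using assms(2,3)
proof (induction n rule: int_ge_induct)
  case base
  define a b where "a = xi p q r 1" and "b = xi p q r 2"
  define L where "L = lam p q r 1"
  define T where "T = tau p q r 1 i"
  have ab: "a > 1" "b > 0" "q 1 * (a * b) = p 1" "q 1 * (a - b) = L" "L > 0"
    using xi_props by (simp_all add: a_def b_def L_def)
  have T: "T > 0" unfolding T_def by (rule tau1_pos)
  have "a powi (- i) = (escape_weight - p 0 * inverse a) / T"
    using ab(1) tau1_pos[of i] by (simp add: T_def tau_escape_weight a_def power_int_minus field_simps)
  hence "a powi (- i) - tau p q r 2 0 / T = p 0 * (inverse b - inverse a) / T"
    by (simp add: tau_escape_weight b_def diff_divide_distrib algebra_simps)
  also have "inverse b - inverse a = L / p 1"
    unfolding ab(3,4)[symmetric] using ab(1,2) positive_rates_1 by (simp add: field_simps)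
  finally show ?case
    using ab(5) visits_zero[OF assms(1)]
    by (simp add: half_line_visits_def a_def L_def T_def field_simps)
next
  case (step n)
  define a b where "a = xi p q r 1" and "b = xi p q r 2"
  define L where "L = lam p q r 1"
  have ab: "a > 1" "b > 0" "q 1 * (a - b) = L" "L > 0"
    using xi_props by (simp_all add: a_def b_def L_def)
  have tau: "tau p q r 2 (n + 1) = b * tau p q r 2 n"
    using ab(2) by (simp add: tau_escape_weight b_def power_int_add)
  have a: "a powi (n + 1 - i) = a * a powi (n - i)"
    using ab(1) power_int_add[of a 1 "n - i"] by (simp add: algebra_simps)
  have q: "1 / q 1 = inverse L * (a - b)" unfolding ab(3)[symmetric]
    using ab(3,4) positive_rates_1 by (auto simp: field_simps)
  have "half_line_visits i (n + 1) = b * half_line_visits i n + a powi (n - i) * (1 / q 1)"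
    using half_line_difference[of i "n + 1"] step assms(1) by (simp add: a_def b_def)
  also have "half_line_visits i n = inverse L * (a powi (n - i) - tau p q r 2 n / tau p q r 1 i)"
    using step by (simp add: a_def L_def)
  finally show ?case unfolding q a_def[symmetric] L_def[symmetric] a tau
    by (simp add: algebra_simps)
qed

end

theorem theorem13:
  fixes p q r s :: "nat \<Rightarrow> real" and i0 n :: int
  assumes nonneg: "\<And>i. i \<le> 2 \<Longrightarrow> p i \<ge> 0 \<and> q i \<ge> 0 \<and> r i \<ge> 0 \<and> s i \<ge> 0"
    and sum1: "\<And>i. i \<le> 2 \<Longrightarrow> p i + q i + r i + s i = 1"
    and pos: "\<And>i. i \<in> {1, 2} \<Longrightarrow> p i * q i * s i > 0"
    and r0: "r 0 \<noteq> 1"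
    and start: "i0 > 0"
  shows "(n < 0 \<longrightarrow>
            (\<lambda>k. trans_prob p q r s k i0 n) sums
              (q 0 * eta1 p q r powi n / (q 2 * tau p q r 1 i0)))
       \<and> (n = 0 \<longrightarrow>
            (\<lambda>k. trans_prob p q r s k i0 n) sums inverse (tau p q r 1 i0))
       \<and> (0 < n \<and> n \<le> i0 \<longrightarrow>
            (\<lambda>k. trans_prob p q r s k i0 n) sums
              (inverse (lam p q r 1) *
                (xi p q r 1 powi (n - i0) - tau p q r 2 n / tau p q r 1 i0)))
       \<and> (n \<ge> i0 \<longrightarrow>
            (\<lambda>k. trans_prob p q r s k i0 n) sums
              (inverse (lam p q r 1) * xi p q r 2 powi (n - i0) *
                (1 - tau p q r 2 i0 / tau p q r 1 i0)))"
proof -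
  interpret absorbing_walk p q r s
    using nonneg sum1 pos r0 by unfold_locales
  have "visits i0 n = q 0 * eta1 p q r powi n / (q 2 * tau p q r 1 i0)" if "n < 0"
    using visits_negative[OF start, of "nat (- 1 - n)"] that
    by (simp add: visits_zero[OF start] field_simps)
  moreover have "visits i0 n = inverse (tau p q r 1 i0)" if "n = 0"
    using visits_zero[OF start] that by simp
  moreover have below: "visits i0 m = inverse (lam p q r 1) *
      (xi p q r 1 powi (m - i0) - tau p q r 2 m / tau p q r 1 i0)" if "0 < m" "m \<le> i0" for m
    using half_line_visits_below_start[of i0 m] that start by (simp add: half_line_visits_def)
  moreover have "visits i0 n = inverse (lam p q r 1) * xi p q r 2 powi (n - i0) *
      (1 - tau p q r 2 i0 / tau p q r 1 i0)" if "n \<ge> i0"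
    using visits_beyond_start[OF start that] below[of i0] start by simp
  ultimately show ?thesis using trans_prob_sums_visits[of i0 n] by auto
qed

end
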